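(* Let $f$ be an inner function with $f(0)=0$ and let $\{a_n\}_{n\ge1}$ be a sequence of complex numbers. Let $\mathcal{A}_k$, $k=1,2,\ldots,p$, be finite (nonempty) collections of positive integers such that $$\max\{n: n\in\mathcal{A}_k\}<\min\{n: n\in\mathcal{A}_{k+1}\},\qquad k=1,\ldots,p-1.$$ Consider $$\xi_k=\sum_{n\in\mathcal{A}_k}a_nf^n,\qquad k=1,\ldots,p.$$ Then $$\int_{\partial\mathbb{D}}\prod_{k=1}^{p}|\xi_k|^2\,dm=\prod_{k=1}^{p}\int_{\partial\mathbb{D}}|\xi_k|^2\,dm.$$
   Context: $\mathbb{D}$ is the open unit disc and $m$ is normalized Lebesgue measure on the unit circle $\partial\mathbb{D}$. An inner function is an analytic map $f:\mathbb{D}\to\mathbb{D}$ whose radial limits have modulus one at $m$-almost every point of $\partial\mathbb{D}$; the boundary function, defined $m$-a.e. by $f(z)=\lim_{r\to1^-}f(rz)$, is also denoted $f$. $f^n$ denotes the $n$-th iterate of $f$ (not the power), regarded here as a function defined $m$-a.e. on $\partial\mathbb{D}$. *)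

theory Defs
  imports "HOL-Complex_Analysis.Complex_Analysis" "HOL-Probability.Probability"
begin

(* The completion matters: iterated boundary functions are only determined up to null sets,
   and their junk values there need not be Borel measurable. *)
definition circle_measure :: "complex measure" where
  "circle_measure =
     completion (distr (uniform_measure lborel {0..2 * pi}) (restrict_space borel (sphere 0 1)) cis)"

lemma space_circle_measure: "space circle_measure = sphere 0 1"
  by (simp add: circle_measure_def)

lemma prob_space_circle_measure: "prob_space circle_measure"
proof -
  have "prob_space (uniform_measure lborel {0..2 * pi})"
    by (rule prob_space_uniform_measure) auto
  moreover have "cis \<in> borel_measurable borel"
    by (intro borel_measurable_continuous_onI continuous_intros)
  then have "cis \<in> uniform_measure lborel {0..2 * pi} \<rightarrow>\<^sub>M restrict_space borel (sphere 0 1)"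
    by (intro measurable_restrict_space2) (auto simp: measurable_def)
  ultimately show ?thesis
    unfolding circle_measure_def
    by (intro prob_space.prob_space_completion prob_space.prob_space_distr)
qed

definition inner_function :: "(complex \<Rightarrow> complex) \<Rightarrow> bool" where
  "inner_function f \<longleftrightarrow>
     f holomorphic_on ball 0 1 \<and> f ` ball 0 1 \<subseteq> ball 0 1 \<and>
     (AE z in circle_measure.
        \<exists>w. ((\<lambda>r. f (complex_of_real r * z)) \<longlongrightarrow> w) (at_left 1) \<and> cmod w = 1)"

(* For an inner function this is meaningful at almost every point of the circle only; where the
   radial limit does not exist the value is unspecified. *)
definition boundary_fun :: "(complex \<Rightarrow> complex) \<Rightarrow> complex \<Rightarrow> complex" where
  "boundary_fun f z = Lim (at_left 1) (\<lambda>r. f (complex_of_real r * z))"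

(* The iterates are those of the boundary map. If f 0 = 0, that map preserves circle_measure,
   so almost every orbit stays on the circle and avoids the unspecified values. *)
definition iterate_sum ::
  "(complex \<Rightarrow> complex) \<Rightarrow> (nat \<Rightarrow> complex) \<Rightarrow> nat set \<Rightarrow> complex \<Rightarrow> complex" where
  "iterate_sum f a A z = (\<Sum>n\<in>A. a n * (boundary_fun f ^^ n) z)"

end

theory Submission imports Defs begin

text \<open>
  Let \<open>T\<close> be the boundary map of \<open>f\<close> and \<open>d = deriv f 0\<close>. The mean value property, applied to the powers of \<open>f\<close>
  and to their products with \<open>z\<close> and with \<open>1 / z\<close>, shows that for \<open>\<bar>c\<bar> \<le> 1\<close> the map \<open>T\<close> transports the measure with
  density \<open>1 + Re (c * cnj z)\<close> to the one with density \<open>1 + Re (c * d * cnj z)\<close>: their moments agree, and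
  moments determine a finite measure on the circle (\<open>circle_moments_determine_measure\<close>, \<open>distr_weight\<close>).
  For \<open>c = 0\<close> this says that \<open>T\<close> preserves arc length. In general it says that \<open>cnj z\<close> is an eigenfunction,
  with eigenvalue \<open>d\<close>, of the transfer operator of \<open>T\<close>.

  It follows that for \<open>m \<le> n \<le> N\<close> the conditional expectation of \<open>(T ^^ n) z * cnj ((T ^^ m) z)\<close> given \<open>T ^^ N\<close>
  is the constant \<open>d ^ (n - m)\<close>, because the unimodular factor \<open>(T ^^ n) z\<close> meets its own conjugate
  (\<open>integral_correlation_ordered\<close>). Expanding \<open>\<bar>\<xi>\<bar>\<^sup>2\<close> for a block \<open>\<xi>\<close> with indices at most \<open>N\<close> into such products,
  the conditional expectation of \<open>\<bar>\<xi>\<bar>\<^sup>2\<close> given \<open>T ^^ N\<close> is constant as well (\<open>integral_block_times_tail\<close>). All later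
  blocks are functions of \<open>T ^^ N\<close>, so the integral of the product factorizes one block at a time
  (\<open>integral_prod_blocks\<close>).

  The boundary function is defined only almost everywhere. It is replaced by a Borel version with
  values on the circle; as \<open>T\<close> preserves arc length, all iterates of the two agree almost everywhere
  (\<open>AE_funpow_eq\<close>), and the completed measure makes the iterates of the former measurable.
\<close>

section \<open>Normalized arc length on the circle\<close>

text \<open>The measure \<^term>\<open>circle_measure\<close> before completion. Densities and image measures are taken here, where
  measurability of a composition is not an issue; the completion enters only when boundary functions
  defined almost everywhere are replaced by Borel versions.\<close>

definition circle_borel :: "complex measure" where
  "circle_borel = distr (uniform_measure lborel {0..2 * pi}) (restrict_space borel (sphere 0 1)) cis"

lemma circle_measure_eq_completion: "circle_measure = completion circle_borel"
  by (simp add: circle_measure_def circle_borel_def)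

lemma space_circle_borel [simp]: "space circle_borel = sphere 0 1"
  by (simp add: circle_borel_def)

lemma sets_circle_borel: "sets circle_borel = sets (restrict_space borel (sphere 0 1))"
  by (simp add: circle_borel_def)

lemma cis_measurable: "cis \<in> uniform_measure lborel {0..2 * pi} \<rightarrow>\<^sub>M restrict_space borel (sphere 0 1)"
proof -
  have "cis \<in> borel_measurable borel"
    by (intro borel_measurable_continuous_onI continuous_intros)
  then show ?thesis
    by (intro measurable_restrict_space2) (auto simp: measurable_def)
qed

lemma prob_space_circle_borel: "prob_space circle_borel"
proof -
  have "prob_space (uniform_measure lborel {0..2 * pi})"
    by (rule prob_space_uniform_measure) auto
  then show ?thesis
    unfolding circle_borel_def by (rule prob_space.prob_space_distr) (rule cis_measurable)
qed

interpretation circle_borel: prob_space circle_borel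
  by (rule prob_space_circle_borel)

lemma measurable_circle_borelI:
  assumes "f \<in> borel_measurable borel" shows "f \<in> borel_measurable circle_borel"
proof -
  have "f \<in> borel_measurable (restrict_space borel (sphere 0 1))"
    by (rule measurable_restrict_space1[OF assms])
  then show ?thesis
    by (simp add: measurable_cong_sets[OF sets_circle_borel refl])
qed

lemma ident_measurable_circle_borel [measurable]: "(\<lambda>z. z) \<in> borel_measurable circle_borel"
  by (rule measurable_circle_borelI) auto

lemma continuous_measurable_circle_borel:
  fixes f :: "complex \<Rightarrow> complex"
  assumes "continuous_on (sphere 0 1) f" shows "f \<in> borel_measurable circle_borel"
  using borel_measurable_continuous_on_restrict[OF assms]
  by (simp add: measurable_cong_sets[OF sets_circle_borel refl])

lemma measurable_into_circle_borel:
  assumes "T \<in> borel_measurable M" "\<And>z. z \<in> space M \<Longrightarrow> cmod (T z) = 1"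
  shows "T \<in> M \<rightarrow>\<^sub>M circle_borel"
proof -
  have "T \<in> M \<rightarrow>\<^sub>M restrict_space borel (sphere 0 1)"
    using assms by (intro measurable_restrict_space2) auto
  then show ?thesis
    by (simp add: measurable_cong_sets[OF refl sets_circle_borel])
qed

section \<open>Measures on the circle are determined by their moments\<close>

lemma cnj_mult_self_circle: "cmod z = 1 \<Longrightarrow> cnj z * z = 1"
  by (simp add: complex_norm_square[symmetric] mult.commute)

lemma cnj_power_mult_self_circle: "cmod z = 1 \<Longrightarrow> cnj z ^ k * z ^ k = 1"
  by (simp add: cnj_mult_self_circle flip: power_mult_distrib)

text \<open>On the circle \<open>Re z\<close> and \<open>Im z\<close> are combinations of \<open>z\<close> and \<open>cnj z = 1 / z\<close>, so real polynomials are
  trigonometric polynomials there. Clearing the negative powers with one factor \<open>cnj z ^ N\<close> leaves an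
  ordinary polynomial, a form that is closed under sums and products.\<close>

lemma real_polynomial_on_circle:
  assumes "real_polynomial_function (g :: complex \<Rightarrow> real)"
  shows "\<exists>q N. \<forall>z\<in>sphere 0 1. complex_of_real (g z) = cnj z ^ N * poly q z"
  using assms
proof (induction g rule: real_polynomial_function.induct)
  case (linear g)
  interpret bounded_linear g by fact
  let ?\<alpha> = "(complex_of_real (g 1) - \<i> * g \<i>) / 2" and ?\<beta> = "(complex_of_real (g 1) + \<i> * g \<i>) / 2"
  have "complex_of_real (g z) = cnj z ^ 1 * poly [:?\<beta>, 0, ?\<alpha>:] z" if "z \<in> sphere 0 1" for z
  proof -
    have z: "cnj z * z = 1"
      using that by (simp add: cnj_mult_self_circle)
    have "z = Re z *\<^sub>R 1 + Im z *\<^sub>R \<i>"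
      by (simp add: complex_eq_iff)
    then have "g z = Re z * g 1 + Im z * g \<i>"
      by (metis add scaleR real_scaleR_def)
    then have "complex_of_real (g z) = ?\<beta> * cnj z + ?\<alpha> * z"
      by (simp add: complex_eq_iff field_simps)
    also have "\<dots> = ?\<beta> * cnj z + ?\<alpha> * (z * (cnj z * z))"
      by (simp add: z)
    finally show ?thesis
      by (simp add: algebra_simps)
  qed
  then show ?case by blast
next
  case (const c)
  have "\<forall>z\<in>sphere 0 1. complex_of_real c = cnj z ^ 0 * poly [:complex_of_real c:] z" by simp
  then show ?case by blast
next
  case (add f g)
  then obtain q N r M where
    f: "\<And>z. z \<in> sphere 0 1 \<Longrightarrow> complex_of_real (f z) = cnj z ^ N * poly q z" and
    g: "\<And>z. z \<in> sphere 0 1 \<Longrightarrow> complex_of_real (g z) = cnj z ^ M * poly r z"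
    by blast
  have "complex_of_real (f z + g z) = cnj z ^ (N + M) * poly (monom 1 M * q + monom 1 N * r) z"
    if "z \<in> sphere 0 1" for z
  proof -
    have z: "cnj z ^ k * z ^ k = 1" for k
      using that by (simp add: cnj_power_mult_self_circle)
    have "cnj z ^ (N + M) * poly (monom 1 M * q + monom 1 N * r) z =
        (cnj z ^ M * z ^ M) * (cnj z ^ N * poly q z) + (cnj z ^ N * z ^ N) * (cnj z ^ M * poly r z)"
      by (simp add: poly_monom power_add algebra_simps)
    then show ?thesis
      using f[OF that] g[OF that] by (simp only: z of_real_add mult_1)
  qed
  then show ?case by blast
next
  case (mult f g)
  then obtain q N r M where
    f: "\<And>z. z \<in> sphere 0 1 \<Longrightarrow> complex_of_real (f z) = cnj z ^ N * poly q z" and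
    g: "\<And>z. z \<in> sphere 0 1 \<Longrightarrow> complex_of_real (g z) = cnj z ^ M * poly r z"
    by blast
  have "\<forall>z\<in>sphere 0 1. complex_of_real (f z * g z) = cnj z ^ (N + M) * poly (q * r) z"
    by (simp add: f g power_add algebra_simps)
  then show ?case by blast
qed

text \<open>Conjugation supplies the moments of negative order, so the integrals of all trigonometric
  polynomials agree; by the Stone-Weierstrass theorem those of all continuous functions agree. The
  indicator of a closed set is a bounded limit of continuous functions, and the closed sets are an
  intersection-stable generator.\<close>

lemma circle_moments_determine_measure:
  assumes M: "finite_measure M" "sets M = sets circle_borel"
    and N: "finite_measure N" "sets N = sets circle_borel"
    and moments: "\<And>n. (LINT z|M. z ^ n) = (LINT z|N. z ^ n)"
  shows "M = N"
proof -
  interpret M: finite_measure M by (rule M)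
  interpret N: finite_measure N by (rule N)
  have spM: "space M = sphere 0 1" and spN: "space N = sphere 0 1"
    using sets_eq_imp_space_eq[OF M(2)] sets_eq_imp_space_eq[OF N(2)] by auto
  have meas: "h \<in> borel_measurable M" "h \<in> borel_measurable N" if "h \<in> borel_measurable borel"
    for h :: "complex \<Rightarrow> 'b::topological_space"
    using measurable_circle_borelI[OF that] M(2) N(2) by (simp_all cong: measurable_cong_sets)
  have int: "integrable M h" "integrable N h"
    if "continuous_on UNIV h" for h :: "complex \<Rightarrow> 'c::{banach, second_countable_topology}"
  proof -
    have "compact (h ` sphere 0 1)"
      by (intro compact_continuous_image continuous_on_subset[OF that]) auto
    then obtain B where B: "\<And>z. z \<in> sphere 0 1 \<Longrightarrow> norm (h z) \<le> B"
      unfolding bounded_iff by (meson compact_imp_bounded bounded_iff imageI)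
    have h: "h \<in> borel_measurable borel"
      by (rule borel_measurable_continuous_onI[OF that])
    show "integrable M h"
      using meas(1)[OF h] by (intro M.integrable_const_bound[of _ B] AE_I2) (auto simp: spM intro!: B)
    show "integrable N h"
      using meas(2)[OF h] by (intro N.integrable_const_bound[of _ B] AE_I2) (auto simp: spN intro!: B)
  qed
  have mixed: "(LINT z|M. cnj z ^ j * z ^ k) = (LINT z|N. cnj z ^ j * z ^ k)" for j k
  proof (cases "j \<le> k")
    case True
    have eq: "cnj z ^ j * z ^ k = z ^ (k - j)" if "z \<in> sphere 0 1" for z
    proof -
      have "z ^ k = z ^ j * z ^ (k - j)"
        using True by (simp flip: power_add)
      moreover have "cnj z ^ j * z ^ j = 1"
        using that by (simp add: cnj_power_mult_self_circle)
      ultimately show ?thesis by (simp flip: mult.assoc)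
    qed
    have "(LINT z|M. cnj z ^ j * z ^ k) = (LINT z|M. z ^ (k - j))"
      by (rule Bochner_Integration.integral_cong) (simp_all add: spM eq)
    moreover have "(LINT z|N. cnj z ^ j * z ^ k) = (LINT z|N. z ^ (k - j))"
      by (rule Bochner_Integration.integral_cong) (simp_all add: spN eq)
    ultimately show ?thesis by (simp add: moments)
  next
    case False
    have eq: "cnj z ^ j * z ^ k = cnj (z ^ (j - k))" if "z \<in> sphere 0 1" for z
    proof -
      have "cnj z ^ j = cnj z ^ (j - k) * cnj z ^ k"
        using False by (simp flip: power_add)
      moreover have "cnj z ^ k * z ^ k = 1"
        using that by (simp add: cnj_power_mult_self_circle)
      ultimately show ?thesis by (simp add: mult.assoc)
    qed
    have "(LINT z|M. cnj z ^ j * z ^ k) = (LINT z|M. cnj (z ^ (j - k)))"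
      by (rule Bochner_Integration.integral_cong) (simp_all add: spM eq del: complex_cnj_power)
    also have "\<dots> = cnj (LINT z|M. z ^ (j - k))"
      by (rule Bochner_Integration.integral_cnj)
    also have "\<dots> = cnj (LINT z|N. z ^ (j - k))"
      by (simp only: moments)
    also have "\<dots> = (LINT z|N. cnj (z ^ (j - k)))"
      by (rule Bochner_Integration.integral_cnj[symmetric])
    also have "\<dots> = (LINT z|N. cnj z ^ j * z ^ k)"
      by (rule Bochner_Integration.integral_cong) (simp_all add: spN eq del: complex_cnj_power)
    finally show ?thesis .
  qed
  have poly_eq: "(LINT z|M. g z) = (LINT z|N. g z)" if g: "real_polynomial_function g" for g
  proof -
    obtain q j where q: "\<And>z. z \<in> sphere 0 1 \<Longrightarrow> complex_of_real (g z) = cnj z ^ j * poly q z"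
      using real_polynomial_on_circle[OF g] by blast
    have expand: "complex_of_real (g z) = (\<Sum>k\<le>degree q. coeff q k * (cnj z ^ j * z ^ k))"
      if "z \<in> sphere 0 1" for z
      by (simp add: q[OF that] poly_altdef sum_distrib_left algebra_simps)
    have "complex_of_real (LINT z|M. g z) = (LINT z|M. complex_of_real (g z))"
      by (rule integral_complex_of_real[symmetric])
    also have "\<dots> = (LINT z|M. (\<Sum>k\<le>degree q. coeff q k * (cnj z ^ j * z ^ k)))"
      by (rule Bochner_Integration.integral_cong) (simp_all add: spM expand)
    also have "\<dots> = (\<Sum>k\<le>degree q. coeff q k * (LINT z|M. cnj z ^ j * z ^ k))"
      by (subst Bochner_Integration.integral_sum) (auto intro!: int continuous_intros)
    also have "\<dots> = (\<Sum>k\<le>degree q. coeff q k * (LINT z|N. cnj z ^ j * z ^ k))"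
      by (simp only: mixed)
    also have "\<dots> = (LINT z|N. (\<Sum>k\<le>degree q. coeff q k * (cnj z ^ j * z ^ k)))"
      by (subst Bochner_Integration.integral_sum) (auto intro!: int continuous_intros)
    also have "\<dots> = (LINT z|N. complex_of_real (g z))"
      by (rule Bochner_Integration.integral_cong) (simp_all add: spN expand)
    also have "\<dots> = complex_of_real (LINT z|N. g z)"
      by (rule integral_complex_of_real)
    finally show ?thesis by simp
  qed
  have cont_eq: "(LINT z|M. g z) = (LINT z|N. g z)" if g: "continuous_on UNIV g" for g :: "complex \<Rightarrow> real"
  proof -
    \<comment> \<open>the summand 1 keeps \<open>K\<close> positive when both measures vanish\<close>
    define K where "K = measure M (space M) + measure N (space N) + 1"
    have K: "K > 0" by (simp add: K_def add_nonneg_pos)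
    have "\<bar>(LINT z|M. g z) - (LINT z|N. g z)\<bar> \<le> 0 + e" if "e > 0" for e
    proof -
      have "e / K > 0" using that K by simp
      then obtain p where p: "real_polynomial_function p"
        "\<And>z. z \<in> sphere 0 1 \<Longrightarrow> \<bar>g z - p z\<bar> < e / K"
        using Stone_Weierstrass_real_polynomial_function[of "sphere 0 1" g "e / K"]
          continuous_on_subset[OF g] by (metis compact_sphere subset_UNIV)
      have pc: "continuous_on UNIV p"
        using p(1) by (simp add: continuous_on_polymonial_function real_polynomial_function_eq)
      have "\<bar>LINT z|M. g z - p z\<bar> \<le> (LINT z|M. e / K)"
        using int(1)[OF g] int(1)[OF pc]
        by (intro integral_abs_bound_integral Bochner_Integration.integrable_diff)
          (auto simp: spM intro: less_imp_le[OF p(2)])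
      moreover have "\<bar>LINT z|N. g z - p z\<bar> \<le> (LINT z|N. e / K)"
        using int(2)[OF g] int(2)[OF pc]
        by (intro integral_abs_bound_integral Bochner_Integration.integrable_diff)
          (auto simp: spN intro: less_imp_le[OF p(2)])
      moreover have "(LINT z|M. g z - p z) = (LINT z|M. g z) - (LINT z|M. p z)"
        by (intro Bochner_Integration.integral_diff int g pc)
      moreover have "(LINT z|N. g z - p z) = (LINT z|N. g z) - (LINT z|N. p z)"
        by (intro Bochner_Integration.integral_diff int g pc)
      moreover have "(LINT z|M. p z) = (LINT z|N. p z)"
        by (rule poly_eq[OF p(1)])
      moreover have "(LINT z|M. e / K) + (LINT z|N. e / K) = (K - 1) * (e / K)"
        by (simp add: K_def algebra_simps add_divide_distrib)
      moreover have "(K - 1) * (e / K) \<le> e"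
        using K that by (simp add: field_simps)
      ultimately show ?thesis by linarith
    qed
    then have "\<bar>(LINT z|M. g z) - (LINT z|N. g z)\<bar> \<le> 0"
      by (rule field_le_epsilon)
    then show ?thesis by simp
  qed
  have closed_eq: "measure M (C \<inter> sphere 0 1) = measure N (C \<inter> sphere 0 1)" if C: "closed C" "C \<noteq> {}" for C
  proof -
    \<comment> \<open>continuous tent functions that decrease to the indicator of \<open>C\<close>\<close>
    define s where "s n z = max 0 (1 - real n * infdist z C)" for n z
    have sc: "continuous_on UNIV (s n)" for n
      unfolding s_def by (intro continuous_intros)
    have sm: "s n \<in> borel_measurable borel" for n
      by (rule borel_measurable_continuous_onI[OF sc])
    have Cm: "C \<in> sets borel" using C by auto
    have lim: "(\<lambda>n. s n z) \<longlonglongrightarrow> indicator C z" for z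
    proof (cases "z \<in> C")
      case True
      then show ?thesis by (simp add: s_def)
    next
      case False
      then have d: "infdist z C > 0"
        using C by (metis in_closed_iff_infdist_zero infdist_nonneg less_eq_real_def)
      obtain n0 where n0: "1 < real n0 * infdist z C"
        using ex_less_of_nat_mult[OF d] by blast
      have "s n z = 0" if "n \<ge> n0" for n
      proof -
        have "real n0 * infdist z C \<le> real n * infdist z C"
          using that d by (intro mult_right_mono) auto
        then show ?thesis using n0 by (simp add: s_def)
      qed
      then have "\<forall>\<^sub>F n in sequentially. s n z = 0"
        by (rule eventually_sequentiallyI)
      then show ?thesis using False by (simp add: tendsto_eventually)
    qed
    have bound: "\<bar>s n z\<bar> \<le> 1" for n z
      by (simp add: s_def infdist_nonneg)
    have iC: "indicator C \<in> borel_measurable (borel :: complex measure)"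
      using Cm by simp
    have "(\<lambda>n. LINT z|M. s n z) \<longlonglongrightarrow> (LINT z|M. indicator C z)"
      by (rule integral_dominated_convergence[where w = "\<lambda>_. 1"])
        (auto intro: meas iC sm lim bound)
    moreover have "(\<lambda>n. LINT z|N. s n z) \<longlonglongrightarrow> (LINT z|N. indicator C z)"
      by (rule integral_dominated_convergence[where w = "\<lambda>_. 1"])
        (auto intro: meas iC sm lim bound)
    ultimately have "(LINT z|M. indicator C z :: real) = (LINT z|N. indicator C z)"
      using LIMSEQ_unique cont_eq[OF sc] by simp
    then show ?thesis
      by (simp add: spM spN Int_commute)
  qed
  \<comment> \<open>transport to the whole plane, where the closed sets generate the Borel sets\<close>
  let ?M = "distr M borel (\<lambda>z. z)" and ?N = "distr N borel (\<lambda>z. z)"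
  have idM: "(\<lambda>z. z) \<in> borel_measurable M" and idN: "(\<lambda>z. z) \<in> borel_measurable N"
    by (auto intro: meas)
  have "?M = ?N"
  proof (rule measure_eqI_generator_eq[where E = "Collect closed" and \<Omega> = UNIV and A = "\<lambda>_. UNIV"])
    show "Int_stable (Collect closed :: complex set set)" by (auto simp: Int_stable_def)
    show "sets ?M = sigma_sets UNIV (Collect closed)" "sets ?N = sigma_sets UNIV (Collect closed)"
      by (simp_all add: borel_eq_closed)
    show "emeasure ?M UNIV \<noteq> \<infinity>"
      using idM by (simp add: emeasure_distr M.emeasure_eq_measure)
    fix X :: "complex set" assume "X \<in> Collect closed"
    then have X: "closed X" by simp
    show "emeasure ?M X = emeasure ?N X"
    proof (cases "X = {}")
      case False
      then show ?thesis
        using closed_eq[OF X] X idM idN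
        by (simp add: emeasure_distr spM spN M.emeasure_eq_measure N.emeasure_eq_measure)
    qed simp
  qed auto
  show ?thesis
  proof (rule measure_eqI)
    show "sets M = sets N" using M(2) N(2) by simp
    fix X assume "X \<in> sets M"
    then have "X \<in> sets (restrict_space borel (sphere 0 1))"
      using M(2) sets_circle_borel by simp
    then have X: "X \<in> sets borel" "X \<subseteq> sphere 0 1"
      by (auto simp: sets_restrict_space)
    have "emeasure M X = emeasure ?M X"
      using X idM by (simp add: emeasure_distr spM Int_absorb2)
    also have "\<dots> = emeasure N X"
      using X idN by (simp add: \<open>?M = ?N\<close> emeasure_distr spN Int_absorb2)
    finally show "emeasure M X = emeasure N X" .
  qed
qed

section \<open>The mean value property up to the boundary\<close>

lemma integrable_circle_borel_bounded:
  fixes h :: "complex \<Rightarrow> 'b::{banach, second_countable_topology}"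
  assumes "h \<in> borel_measurable circle_borel" "\<And>z. cmod z = 1 \<Longrightarrow> norm (h z) \<le> B"
  shows "integrable circle_borel h"
  using assms by (intro circle_borel.integrable_const_bound[of _ B] AE_I2) auto

lemma integral_circle_borel_cis:
  fixes h :: "complex \<Rightarrow> complex"
  assumes h: "continuous_on (sphere 0 1) h"
    and I: "((\<lambda>t. h (cis t)) has_integral I) {0..2 * pi}"
  shows "(LINT z|circle_borel. h z) = I / (2 * pi)"
proof -
  let ?U = "{0..2 * pi}"
  have cont: "continuous_on UNIV (\<lambda>t. h (cis t))"
    by (rule continuous_on_compose2[OF h]) (auto intro!: continuous_intros)
  have meas: "(\<lambda>t. h (cis t)) \<in> borel_measurable lborel"
    using borel_measurable_continuous_onI[OF cont] by simp
  have sint: "set_integrable lborel ?U (\<lambda>t. h (cis t))"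
    by (rule borel_integrable_atLeastAtMost') (rule continuous_on_subset[OF cont], simp)
  have U: "uniform_measure lborel ?U = density lborel (\<lambda>t. ennreal (indicator ?U t / (2 * pi)))"
    unfolding uniform_measure_def
    by (rule density_cong) (auto simp: divide_ennreal[symmetric] indicator_def)
  have "(LINT z|circle_borel. h z) = (LINT t|uniform_measure lborel ?U. h (cis t))"
    unfolding circle_borel_def
    by (rule integral_distr[OF cis_measurable borel_measurable_continuous_on_restrict[OF h]])
  also have "\<dots> = (LINT t|lborel. (indicator ?U t / (2 * pi)) *\<^sub>R h (cis t))"
    unfolding U by (rule integral_density[OF meas]) auto
  also have "\<dots> = (LINT t|lborel. (1 / (2 * pi)) *\<^sub>R (indicator ?U t *\<^sub>R h (cis t)))"
    by (rule Bochner_Integration.integral_cong) auto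
  also have "\<dots> = (1 / (2 * pi)) *\<^sub>R (LINT t:?U|lborel. h (cis t))"
    by (simp only: integral_scaleR_right set_lebesgue_integral_def)
  also have "(LINT t:?U|lborel. h (cis t)) = I"
    using set_borel_integral_eq_integral(2)[OF sint] integral_unique[OF I] by simp
  finally show ?thesis by (simp add: scaleR_conv_of_real)
qed

lemma circle_mean_value:
  assumes hol: "h holomorphic_on ball 0 1" and r: "0 < r" "r < 1"
  shows "(LINT z|circle_borel. h (complex_of_real r * z)) = h 0"
proof -
  have cont: "continuous_on (ball 0 1) h"
    using hol by (rule holomorphic_on_imp_continuous_on)
  have "((\<lambda>u. h u / (u - 0)) has_contour_integral (2 * of_real pi * \<i> * h 0)) (circlepath 0 r)"
    using r by (intro Cauchy_integral_circlepath continuous_on_subset[OF cont]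
        holomorphic_on_subset[OF hol]) auto
  then have "((\<lambda>t. h (0 + r * cis t) / (0 + r * cis t - 0) * r * \<i> * cis t)
      has_integral (2 * of_real pi * \<i> * h 0)) {0..2 * pi}"
    unfolding circlepath_def by (subst (asm) has_contour_integral_part_circlepath_iff) auto
  then have "((\<lambda>t. \<i> * h (r * cis t)) has_integral (2 * of_real pi * \<i> * h 0)) {0..2 * pi}"
    using r by (simp add: mult.commute)
  moreover have cancel: "- \<i> * (\<i> * w) = w" "- \<i> * (2 * of_real pi * \<i> * w) = 2 * of_real pi * w"
    for w :: complex
    by (simp_all add: complex_eq_iff)
  ultimately have "((\<lambda>t. - \<i> * (\<i> * h (r * cis t))) has_integral
      - \<i> * (2 * of_real pi * \<i> * h 0)) {0..2 * pi}"
    by (intro has_integral_mult_right)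
  then
  have "((\<lambda>t. h (r * cis t)) has_integral (2 * of_real pi * h 0)) {0..2 * pi}"
    by (simp only: cancel)
  moreover have "continuous_on (sphere 0 1) (\<lambda>z. h (complex_of_real r * z))"
    using r by (intro continuous_on_compose2[OF cont] continuous_intros)
      (auto simp: norm_mult)
  ultimately show ?thesis
    by (subst integral_circle_borel_cis) auto
qed

text \<open>One fixed sequence of radii replaces the limit over all radii, so that a radial limit is a limit of
  countably many measurable functions.\<close>

definition radius :: "nat \<Rightarrow> real" where
  "radius n = 1 - inverse (real (n + 2))"

lemma radius_bounds: "0 < radius n" "radius n < 1"
  by (simp_all add: radius_def field_simps)

lemma radius_at_left: "filterlim radius (at_left 1) sequentially"
proof -
  have "radius \<longlonglongrightarrow> 1"
    unfolding radius_def by real_asymp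
  then show ?thesis
    by (auto simp: filterlim_at radius_bounds less_imp_neq[OF radius_bounds(2)] intro!: always_eventually)
qed

lemma radius_LIMSEQ: "(\<lambda>n. complex_of_real (radius n)) \<longlonglongrightarrow> 1"
proof -
  have "radius \<longlonglongrightarrow> 1"
    unfolding radius_def by real_asymp
  from tendsto_of_real[OF this] show ?thesis by simp
qed

lemma norm_radius_mult: "cmod z = 1 \<Longrightarrow> cmod (complex_of_real (radius n) * z) < 1"
  using radius_bounds[of n] by (simp add: norm_mult)

lemma radial_sample_measurable:
  fixes h :: "complex \<Rightarrow> complex"
  assumes "continuous_on (ball 0 1) h"
  shows "(\<lambda>z. h (complex_of_real (radius n) * z)) \<in> borel_measurable circle_borel"
  by (intro continuous_measurable_circle_borel continuous_on_compose2[OF assms] continuous_intros)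
    (auto intro: norm_radius_mult)

text \<open>The mean value property holds on each smaller circle by Cauchy's formula; boundedness carries it to
  the unit circle by dominated convergence. All integrals of boundary functions below are instances.\<close>

lemma boundary_mean_value:
  assumes hol: "h holomorphic_on ball 0 1"
    and bound: "\<And>z. cmod z < 1 \<Longrightarrow> cmod (h z) \<le> B"
    and b: "b \<in> borel_measurable circle_borel"
    and lim: "AE z in circle_borel. (\<lambda>n. h (complex_of_real (radius n) * z)) \<longlonglongrightarrow> b z"
  shows "(LINT z|circle_borel. b z) = h 0"
proof -
  have "(\<lambda>n. LINT z|circle_borel. h (complex_of_real (radius n) * z)) \<longlonglongrightarrow> (LINT z|circle_borel. b z)"
    using b lim
    by (intro integral_dominated_convergence[where w = "\<lambda>_. B"] radial_sample_measurable
        holomorphic_on_imp_continuous_on[OF hol])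
      (auto intro!: AE_I2 bound norm_radius_mult)
  moreover have "(LINT z|circle_borel. h (complex_of_real (radius n) * z)) = h 0" for n
    by (rule circle_mean_value[OF hol radius_bounds])
  ultimately show ?thesis
    by (simp add: LIMSEQ_const_iff)
qed

section \<open>The boundary map and its action on weighted arc length\<close>

text \<open>A holomorphic self-map of the disc that fixes \<open>0\<close>, together with a Borel self-map \<open>T\<close> of the circle that is
  its radial limit almost everywhere. That \<open>T\<close> maps the circle into itself is what makes \<open>f\<close> inner.\<close>

locale disc_map_with_boundary =
  fixes f T :: "complex \<Rightarrow> complex"
  assumes holomorphic: "f holomorphic_on ball 0 1"
    and maps_disc: "f ` ball 0 1 \<subseteq> ball 0 1"
    and fixes_0: "f 0 = 0"
    and T_measurable: "T \<in> circle_borel \<rightarrow>\<^sub>M circle_borel"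
    and radial_limit: "AE z in circle_borel. (\<lambda>n. f (complex_of_real (radius n) * z)) \<longlonglongrightarrow> T z"
begin

lemma norm_T: "cmod z = 1 \<Longrightarrow> cmod (T z) = 1"
  using measurable_space[OF T_measurable, of z] by simp

lemma T_borel_measurable: "T \<in> borel_measurable circle_borel"
  using measurable_compose[OF T_measurable ident_measurable_circle_borel] .

lemma disc_bound: "cmod z < 1 \<Longrightarrow> cmod (f z) \<le> 1"
  using maps_disc by (force simp: image_subset_iff intro: less_imp_le)

lemma integral_T_power: "(LINT z|circle_borel. T z ^ n) = 0 ^ n"
proof -
  have "(LINT z|circle_borel. T z ^ n) = f 0 ^ n"
  proof (rule boundary_mean_value[where B = 1 and h = "\<lambda>z. f z ^ n"])
    show "AE z in circle_borel. (\<lambda>k. f (complex_of_real (radius k) * z) ^ n) \<longlonglongrightarrow> T z ^ n"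
      using radial_limit by eventually_elim (rule tendsto_power)
  qed (auto intro!: holomorphic_intros holomorphic borel_measurable_power T_borel_measurable
      power_le_one disc_bound simp: norm_power)
  then show ?thesis by (simp add: fixes_0)
qed

lemma integral_ident_T_power: "(LINT z|circle_borel. z * T z ^ n) = 0"
proof -
  have "(LINT z|circle_borel. z * T z ^ n) = 0 * f 0 ^ n"
  proof (rule boundary_mean_value[where B = 1 and h = "\<lambda>z. z * f z ^ n"])
    show "AE z in circle_borel. (\<lambda>k. complex_of_real (radius k) * z *
        f (complex_of_real (radius k) * z) ^ n) \<longlonglongrightarrow> z * T z ^ n"
      using radial_limit
    proof eventually_elim
      case (elim z)
      have "(\<lambda>k. complex_of_real (radius k) * z * f (complex_of_real (radius k) * z) ^ n)
          \<longlonglongrightarrow> 1 * z * T z ^ n"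
        by (intro tendsto_mult tendsto_power tendsto_const radius_LIMSEQ elim)
      then show ?case by simp
    qed
    show "cmod (z * f z ^ n) \<le> 1" if "cmod z < 1" for z
      using that by (auto simp: norm_mult norm_power intro!: mult_le_one power_le_one disc_bound)
    show "(\<lambda>z. z * T z ^ n) \<in> borel_measurable circle_borel"
      by (intro borel_measurable_times borel_measurable_power T_borel_measurable
          ident_measurable_circle_borel)
  qed (auto intro!: holomorphic_intros holomorphic)
  then show ?thesis by simp
qed

text \<open>Since \<open>f 0 = 0\<close>, there is a holomorphic \<open>q\<close> with \<open>f z = z * q z\<close> and \<open>q 0 = deriv f 0\<close>, bounded by \<open>1\<close>
  according to Schwarz's lemma. On the circle \<open>cnj z\<close> inverts \<open>z\<close>, hence \<open>cnj z * T z ^ Suc m\<close> is the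
  boundary function of \<open>q * f ^ m\<close>, whose value at \<open>0\<close> vanishes unless \<open>m = 0\<close>.\<close>

lemma integral_cnj_T_power:
  "(LINT z|circle_borel. cnj z * T z ^ n) = (if n = 1 then deriv f 0 else 0)"
proof (cases n)
  case 0
  have "(LINT z|circle_borel. cnj z) = cnj (LINT z|circle_borel. z * T z ^ 0)"
    by simp
  then show ?thesis
    using 0 by (simp only: integral_ident_T_power) simp
next
  case (Suc m)
  obtain q where q: "q holomorphic_on ball 0 1" "\<And>z. cmod z < 1 \<Longrightarrow> f z = z * q z"
    "deriv f 0 = q 0"
    using Schwarz3[OF holomorphic fixes_0] by metis
  have self: "\<And>z. cmod z < 1 \<Longrightarrow> cmod (f z) < 1"
    using maps_disc by force
  have q_bound: "cmod (q z) \<le> 1" if z: "cmod z < 1" for z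
  proof (cases "z = 0")
    case True
    then show ?thesis
      using Schwarz_Lemma(2)[OF holomorphic fixes_0 self, of 0] q(3) by simp
  next
    case False
    have "cmod z * cmod (q z) \<le> cmod z * 1"
      using Schwarz_Lemma(1)[OF holomorphic fixes_0 self z] q(2)[OF z] by (simp add: norm_mult)
    then show ?thesis using False by simp
  qed
  have "(LINT z|circle_borel. cnj z * T z ^ n) = q 0 * f 0 ^ m"
  proof (rule boundary_mean_value[where B = 1 and h = "\<lambda>z. q z * f z ^ m"])
    show "AE z in circle_borel. (\<lambda>k. q (complex_of_real (radius k) * z) *
        f (complex_of_real (radius k) * z) ^ m) \<longlonglongrightarrow> cnj z * T z ^ n"
      using radial_limit AE_space
    proof eventually_elim
      case (elim z)
      then have z: "cmod z = 1" by simp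
      let ?r = "\<lambda>k. complex_of_real (radius k)"
      have "q (?r k * z) = inverse (?r k) * (cnj z * f (?r k * z))" for k
        using q(2)[OF norm_radius_mult[OF z, of k]] cnj_mult_self_circle[OF z] radius_bounds[of k]
        by (simp add: field_simps)
      moreover have "(\<lambda>k. inverse (?r k) * (cnj z * f (?r k * z)) * f (?r k * z) ^ m)
          \<longlonglongrightarrow> inverse 1 * (cnj z * T z) * T z ^ m"
        by (intro tendsto_mult tendsto_inverse tendsto_power tendsto_const radius_LIMSEQ elim) simp
      ultimately show ?case by (simp add: Suc mult.assoc)
    qed
    show "cmod (q z * f z ^ m) \<le> 1" if "cmod z < 1" for z
      using that by (auto simp: norm_mult norm_power intro!: mult_le_one power_le_one disc_bound q_bound)
    show "(\<lambda>z. cnj z * T z ^ n) \<in> borel_measurable circle_borel"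
      by (intro borel_measurable_times borel_measurable_power T_borel_measurable
          continuous_measurable_circle_borel continuous_intros)
  qed (intro holomorphic_intros holomorphic q(1))
  then show ?thesis using q(3) Suc by (simp add: fixes_0 power_0_left)
qed

text \<open>The answer depends on \<open>f\<close> and \<open>c\<close> through \<open>c * deriv f 0\<close> alone, so it is unchanged when \<open>f\<close> is replaced
  by the identity and \<open>c\<close> by \<open>c * deriv f 0\<close>.\<close>

lemma weighted_T_moment:
  "(LINT z|circle_borel. (1 + Re (c * cnj z)) *\<^sub>R T z ^ n)
     = 0 ^ n + (if n = 1 then c * deriv f 0 / 2 else 0)"
proof -
  have meas: "(\<lambda>z. T z ^ n) \<in> borel_measurable circle_borel"
    by (intro borel_measurable_power T_borel_measurable)
  have cm: "cnj \<in> borel_measurable circle_borel"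
    by (intro continuous_measurable_circle_borel continuous_intros)
  have i1: "integrable circle_borel (\<lambda>z. T z ^ n)"
    using meas by (rule integrable_circle_borel_bounded[where B = 1]) (simp add: norm_power norm_T)
  have i2: "integrable circle_borel (\<lambda>z. cnj z * T z ^ n)"
    by (rule integrable_circle_borel_bounded[where B = 1])
      (auto simp: norm_mult norm_power norm_T intro!: borel_measurable_times meas cm)
  have i3: "integrable circle_borel (\<lambda>z. z * T z ^ n)"
    by (rule integrable_circle_borel_bounded[where B = 1])
      (auto simp: norm_mult norm_power norm_T intro!: borel_measurable_times meas)
  have re: "complex_of_real (Re (c * cnj z)) = c / 2 * cnj z + cnj c / 2 * z" for z
    by (simp add: complex_eq_iff field_simps)
  have "(1 + Re (c * cnj z)) *\<^sub>R T z ^ n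
      = T z ^ n + (c / 2) * (cnj z * T z ^ n) + (cnj c / 2) * (z * T z ^ n)" for z
    unfolding scaleR_conv_of_real of_real_add re by (simp add: algebra_simps)
  then have "(LINT z|circle_borel. (1 + Re (c * cnj z)) *\<^sub>R T z ^ n)
      = (LINT z|circle_borel. T z ^ n) + (c / 2) * (LINT z|circle_borel. cnj z * T z ^ n)
        + (cnj c / 2) * (LINT z|circle_borel. z * T z ^ n)"
    using i1 i2 i3 by simp
  then show ?thesis
    by (simp add: integral_T_power integral_cnj_T_power integral_ident_T_power)
qed

end

lemma ident_disc_map: "disc_map_with_boundary (\<lambda>z. z) (\<lambda>z. z)"
proof
  show "AE z in circle_borel. (\<lambda>n. complex_of_real (radius n) * z) \<longlonglongrightarrow> z"
    using tendsto_mult_right[OF radius_LIMSEQ] by (intro AE_I2) fastforce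
qed auto

lemma weight_nonneg: "cmod c \<le> 1 \<Longrightarrow> cmod z = 1 \<Longrightarrow> 0 \<le> 1 + Re (c * cnj z)"
  using abs_Re_le_cmod[of "c * cnj z"] by (simp add: norm_mult)

lemma weight_measurable: "(\<lambda>z. 1 + Re (c * cnj z)) \<in> borel_measurable circle_borel"
  by (intro measurable_circle_borelI borel_measurable_continuous_onI continuous_intros)

context disc_map_with_boundary
begin

lemma norm_deriv_le_1: "cmod (deriv f 0) \<le> 1"
  using maps_disc by (intro Schwarz_Lemma(2)[OF holomorphic fixes_0, of 0]) force+

text \<open>The transfer operator of \<open>T\<close> sends the density \<open>1 + Re (c * cnj z)\<close> to one of the same shape, with \<open>c\<close>
  multiplied by \<open>deriv f 0\<close>. In other words, \<open>cnj z\<close> is an eigenfunction of the transfer operator. The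
  constant \<open>1\<close> and the bound on \<open>c\<close> keep the densities nonnegative; both sides have the moments computed in
  \<open>weighted_T_moment\<close>, for \<open>T\<close> and for the identity.\<close>

lemma distr_weight:
  assumes c: "cmod c \<le> 1"
  shows "distr (density circle_borel (\<lambda>z. ennreal (1 + Re (c * cnj z)))) circle_borel T
       = density circle_borel (\<lambda>z. ennreal (1 + Re (c * deriv f 0 * cnj z)))"
    (is "distr ?M _ _ = ?N")
proof (rule circle_moments_determine_measure)
  have c': "cmod (c * deriv f 0) \<le> 1"
    using c norm_deriv_le_1 by (simp add: norm_mult mult_le_one)
  have fin: "finite_measure (density circle_borel (\<lambda>z. ennreal (1 + Re (d * cnj z))))"
    if d: "cmod d \<le> 1" for d
  proof -
    have "integrable circle_borel (\<lambda>z. 1 + Re (d * cnj z))"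
      using weight_measurable
    proof (rule integrable_circle_borel_bounded[where B = 2])
      show "norm (1 + Re (d * cnj z)) \<le> 2" if "cmod z = 1" for z
        using abs_Re_le_cmod[of "d * cnj z"] d that by (simp add: norm_mult)
    qed
    from integrableD(2)[OF this]
    have "(\<integral>\<^sup>+ z. ennreal (1 + Re (d * cnj z)) \<partial>circle_borel) \<noteq> \<infinity>" .
    also have "(\<integral>\<^sup>+ z. ennreal (1 + Re (d * cnj z)) \<partial>circle_borel)
        = (\<integral>\<^sup>+ z. ennreal (1 + Re (d * cnj z)) * indicator (space circle_borel) z \<partial>circle_borel)"
      by (intro nn_integral_cong) simp
    also have "\<dots> = emeasure (density circle_borel (\<lambda>z. ennreal (1 + Re (d * cnj z)))) (space circle_borel)"
      using weight_measurable[of d] by (intro emeasure_density[symmetric] sets.top) auto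
    finally show ?thesis
      by (intro finite_measureI) simp
  qed
  interpret ident: disc_map_with_boundary "\<lambda>z. z" "\<lambda>z. z" by (rule ident_disc_map)
  have T: "T \<in> measurable ?M circle_borel"
    using T_measurable by simp
  show "finite_measure (distr ?M circle_borel T)"
    by (rule finite_measure.finite_measure_distr[OF fin[OF c] T])
  show "finite_measure ?N" by (rule fin[OF c'])
  fix n
  have pm: "(\<lambda>z. z ^ n) \<in> borel_measurable circle_borel"
    by (intro continuous_measurable_circle_borel continuous_intros)
  have "(LINT z|distr ?M circle_borel T. z ^ n) = (LINT z|?M. T z ^ n)"
    by (rule integral_distr[OF T pm])
  also have "\<dots> = (LINT z|circle_borel. (1 + Re (c * cnj z)) *\<^sub>R T z ^ n)"
    using weight_nonneg[OF c]
    by (intro integral_density weight_measurable borel_measurable_power T_borel_measurable) auto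
  also have "\<dots> = (LINT z|circle_borel. (1 + Re (c * deriv f 0 * cnj z)) *\<^sub>R z ^ n)"
    by (simp only: weighted_T_moment ident.weighted_T_moment) simp
  also have "\<dots> = (LINT z|?N. z ^ n)"
    using weight_nonneg[OF c'] by (intro integral_density[symmetric] weight_measurable pm) auto
  finally show "(LINT z|distr ?M circle_borel T. z ^ n) = (LINT z|?N. z ^ n)" .
qed simp_all

text \<open>Loewner's lemma.\<close>

lemma distr_T: "distr circle_borel circle_borel T = circle_borel"
  using distr_weight[of 0] by (simp add: density_1)

lemma funpow_T_measurable: "T ^^ n \<in> circle_borel \<rightarrow>\<^sub>M circle_borel"
  by (rule measurable_compose_n[OF T_measurable])

lemma distr_funpow_T: "distr circle_borel circle_borel (T ^^ n) = circle_borel"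
proof (induction n)
  case 0
  show ?case by (simp add: id_def distr_id)
next
  case (Suc n)
  have "distr circle_borel circle_borel (T ^^ Suc n)
      = distr (distr circle_borel circle_borel (T ^^ n)) circle_borel T"
    by (simp only: distr_distr[OF T_measurable funpow_T_measurable] funpow.simps)
  then show ?case by (simp only: Suc distr_T)
qed

lemma norm_funpow_T: "cmod z = 1 \<Longrightarrow> cmod ((T ^^ n) z) = 1"
  using measurable_space[OF funpow_T_measurable, of z] by simp

lemma integral_funpow_T:
  fixes H :: "complex \<Rightarrow> complex"
  assumes "H \<in> borel_measurable circle_borel"
  shows "(LINT z|circle_borel. H ((T ^^ n) z)) = (LINT z|circle_borel. H z)"
  using integral_distr[OF funpow_T_measurable assms, of n] by (simp add: distr_funpow_T)

lemma integral_weight_T: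
  fixes H :: "complex \<Rightarrow> complex"
  assumes H: "H \<in> borel_measurable circle_borel" and c: "cmod c \<le> 1"
  shows "(LINT z|circle_borel. (1 + Re (c * cnj z)) *\<^sub>R H (T z))
       = (LINT z|circle_borel. (1 + Re (c * deriv f 0 * cnj z)) *\<^sub>R H z)"
proof -
  let ?M = "density circle_borel (\<lambda>z. ennreal (1 + Re (c * cnj z)))"
  let ?N = "density circle_borel (\<lambda>z. ennreal (1 + Re (c * deriv f 0 * cnj z)))"
  have c': "cmod (c * deriv f 0) \<le> 1"
    using c norm_deriv_le_1 by (simp add: norm_mult mult_le_one)
  have "(LINT z|circle_borel. (1 + Re (c * cnj z)) *\<^sub>R H (T z)) = (LINT z|?M. H (T z))"
    using weight_nonneg[OF c]
    by (intro integral_density[symmetric] weight_measurable measurable_compose[OF T_measurable H]) auto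
  also have "\<dots> = (LINT z|distr ?M circle_borel T. H z)"
    using T_measurable by (intro integral_distr[symmetric] H) simp
  also have "\<dots> = (LINT z|?N. H z)"
    by (simp only: distr_weight[OF c])
  also have "\<dots> = (LINT z|circle_borel. (1 + Re (c * deriv f 0 * cnj z)) *\<^sub>R H z)"
    using weight_nonneg[OF c'] by (intro integral_density weight_measurable H) auto
  finally show ?thesis .
qed

text \<open>The eigenfunction property in integrated form. The choices \<open>c = 1\<close> and \<open>c = - \<i>\<close> extract the real and the
  imaginary part of \<open>cnj z\<close> from the weights.\<close>

lemma integral_cnj_T:
  fixes H :: "complex \<Rightarrow> complex"
  assumes H: "H \<in> borel_measurable circle_borel"
    and bound: "\<And>z. cmod z = 1 \<Longrightarrow> cmod (H z) \<le> B"
  shows "(LINT z|circle_borel. cnj z * H (T z)) = deriv f 0 * (LINT z|circle_borel. cnj z * H z)"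
proof -
  let ?d = "deriv f 0"
  have HT: "(\<lambda>z. H (T z)) \<in> borel_measurable circle_borel"
    by (rule measurable_compose[OF T_measurable H])
  have Rm: "(\<lambda>z. Re (c * cnj z)) \<in> borel_measurable circle_borel" for c
    by (intro measurable_circle_borelI borel_measurable_continuous_onI continuous_intros)
  have i0: "integrable circle_borel G"
    if "G \<in> borel_measurable circle_borel" "\<And>z. cmod z = 1 \<Longrightarrow> cmod (G z) \<le> B"
    for G :: "complex \<Rightarrow> complex"
    using that by (rule integrable_circle_borel_bounded)
  have i: "integrable circle_borel (\<lambda>z. Re (c * cnj z) *\<^sub>R G z)"
    if G: "G \<in> borel_measurable circle_borel" "\<And>z. cmod z = 1 \<Longrightarrow> cmod (G z) \<le> B"
    for c and G :: "complex \<Rightarrow> complex"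
  proof (rule integrable_circle_borel_bounded)
    show "(\<lambda>z. Re (c * cnj z) *\<^sub>R G z) \<in> borel_measurable circle_borel"
      by (intro borel_measurable_scaleR Rm G)
    show "norm (Re (c * cnj z) *\<^sub>R G z) \<le> cmod c * B" if z: "cmod z = 1" for z
      using abs_Re_le_cmod[of "c * cnj z"] G(2)[OF z] z
      by (auto simp: norm_mult intro!: mult_mono)
  qed
  have HT_bound: "\<And>z. cmod z = 1 \<Longrightarrow> cmod (H (T z)) \<le> B"
    by (intro bound norm_T)
  have re: "(LINT z|circle_borel. Re (c * cnj z) *\<^sub>R H (T z))
      = (LINT z|circle_borel. Re (c * ?d * cnj z) *\<^sub>R H z)" if c: "cmod c \<le> 1" for c
  proof -
    have "(LINT z|circle_borel. H (T z)) + (LINT z|circle_borel. Re (c * cnj z) *\<^sub>R H (T z))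
        = (LINT z|circle_borel. (1 + Re (c * cnj z)) *\<^sub>R H (T z))"
      unfolding scaleR_add_left scaleR_one
      by (rule Bochner_Integration.integral_add[symmetric]) (intro i0 i HT HT_bound; assumption)+
    also have "\<dots> = (LINT z|circle_borel. (1 + Re (c * ?d * cnj z)) *\<^sub>R H z)"
      by (rule integral_weight_T[OF H c])
    also have "\<dots> = (LINT z|circle_borel. H z) + (LINT z|circle_borel. Re (c * ?d * cnj z) *\<^sub>R H z)"
      unfolding scaleR_add_left scaleR_one
      by (rule Bochner_Integration.integral_add) (intro i0 i H bound; assumption)+
    finally show ?thesis
      using integral_funpow_T[OF H, of 1] by simp
  qed
  have split: "Re (1 * w) *\<^sub>R h + \<i> * (Re (- \<i> * w) *\<^sub>R h) = w * h" for w h :: complex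
    by (simp add: complex_eq_iff algebra_simps)
  have decompose: "(LINT z|circle_borel. c * cnj z * G z)
      = (LINT z|circle_borel. Re (1 * c * cnj z) *\<^sub>R G z)
        + \<i> * (LINT z|circle_borel. Re (- \<i> * c * cnj z) *\<^sub>R G z)"
    if G: "G \<in> borel_measurable circle_borel" "\<And>z. cmod z = 1 \<Longrightarrow> cmod (G z) \<le> B"
    for c and G :: "complex \<Rightarrow> complex"
  proof -
    have "(LINT z|circle_borel. c * cnj z * G z)
        = (LINT z|circle_borel. Re (1 * c * cnj z) *\<^sub>R G z + \<i> * (Re (- \<i> * c * cnj z) *\<^sub>R G z))"
      by (rule Bochner_Integration.integral_cong[OF refl]) (simp only: mult.assoc split)
    also have "\<dots> = (LINT z|circle_borel. Re (1 * c * cnj z) *\<^sub>R G z)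
        + (LINT z|circle_borel. \<i> * (Re (- \<i> * c * cnj z) *\<^sub>R G z))"
      using i[OF G] by (intro Bochner_Integration.integral_add integrable_mult_right)
    finally show ?thesis by (simp only: integral_mult_right_zero)
  qed
  have "(LINT z|circle_borel. 1 * cnj z * H (T z))
      = (LINT z|circle_borel. Re (1 * 1 * cnj z) *\<^sub>R H (T z))
        + \<i> * (LINT z|circle_borel. Re (- \<i> * 1 * cnj z) *\<^sub>R H (T z))"
    by (rule decompose[OF HT HT_bound])
  also have "\<dots> = (LINT z|circle_borel. Re (1 * ?d * cnj z) *\<^sub>R H z)
        + \<i> * (LINT z|circle_borel. Re (- \<i> * ?d * cnj z) *\<^sub>R H z)"
    by (simp only: mult_1_right re[of 1] re[of "- \<i>"] norm_one norm_minus_cancel norm_ii order_refl)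
  also have "\<dots> = (LINT z|circle_borel. ?d * cnj z * H z)"
    by (rule decompose[OF H bound, symmetric])
  also have "\<dots> = ?d * (LINT z|circle_borel. cnj z * H z)"
    by (simp only: mult.assoc integral_mult_right_zero)
  finally show ?thesis by simp
qed

end

context disc_map_with_boundary
begin

section \<open>Correlations of iterates are independent of the future\<close>

lemma prob_circle [simp]: "measure circle_borel (sphere 0 1) = 1"
  using circle_borel.prob_space by simp

lemma integral_cnj_funpow_T:
  fixes H :: "complex \<Rightarrow> complex"
  assumes H: "H \<in> borel_measurable circle_borel"
    and bound: "\<And>z. cmod z = 1 \<Longrightarrow> cmod (H z) \<le> B"
  shows "(LINT z|circle_borel. cnj z * H ((T ^^ j) z))
       = deriv f 0 ^ j * (LINT z|circle_borel. cnj z * H z)"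
proof (induction j)
  case (Suc j)
  have "(LINT z|circle_borel. cnj z * H ((T ^^ Suc j) z))
      = (LINT z|circle_borel. cnj z * H ((T ^^ j) (T z)))"
    by (simp add: funpow_swap1)
  also have "\<dots> = deriv f 0 * (LINT z|circle_borel. cnj z * H ((T ^^ j) z))"
    by (rule integral_cnj_T[OF measurable_compose[OF funpow_T_measurable H] bound[OF norm_funpow_T]])
  finally show ?case by (simp add: Suc)
qed simp

text \<open>Invariance under \<open>T ^^ m\<close> reduces to \<open>m = 0\<close>. The integrand is then \<open>cnj z\<close> times a function of
  \<open>(T ^^ n) z\<close>, so the eigenfunction property turns \<open>(T ^^ n) z * cnj z\<close> into the constant
  \<open>deriv f 0 ^ n * z * cnj z = deriv f 0 ^ n\<close>. That this is constant is the crux: the conditional expectation of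
  \<open>(T ^^ n) z * cnj ((T ^^ m) z)\<close> given \<open>T ^^ N\<close> carries no information.\<close>

lemma integral_correlation_ordered:
  fixes G :: "complex \<Rightarrow> complex"
  assumes G: "G \<in> borel_measurable circle_borel"
    and bound: "\<And>z. cmod z = 1 \<Longrightarrow> cmod (G z) \<le> B"
    and le: "m \<le> n" "n \<le> N"
  shows "(LINT z|circle_borel. (T ^^ n) z * cnj ((T ^^ m) z) * G ((T ^^ N) z))
       = deriv f 0 ^ (n - m) * (LINT z|circle_borel. G z)"
proof -
  have comp: "(T ^^ k) z = (T ^^ (k - l)) ((T ^^ l) z)" if "l \<le> k" for k l z
    using that by (metis comp_apply funpow_add le_add_diff_inverse2)
  define H where "H w = w * G ((T ^^ (N - n)) w)" for w
  have H: "H \<in> borel_measurable circle_borel"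
    unfolding H_def
    by (intro borel_measurable_times ident_measurable_circle_borel
        measurable_compose[OF funpow_T_measurable G])
  have H_bound: "cmod (H z) \<le> B" if "cmod z = 1" for z
    using bound[OF norm_funpow_T[OF that]] that by (simp add: H_def norm_mult)
  have "(T ^^ n) z * cnj ((T ^^ m) z) * G ((T ^^ N) z)
      = cnj ((T ^^ m) z) * H ((T ^^ (n - m)) ((T ^^ m) z))" for z
    using comp[OF le(1), of z] comp[OF le(2), of z] by (simp add: H_def)
  then have "(LINT z|circle_borel. (T ^^ n) z * cnj ((T ^^ m) z) * G ((T ^^ N) z))
      = (LINT z|circle_borel. cnj ((T ^^ m) z) * H ((T ^^ (n - m)) ((T ^^ m) z)))"
    by (simp only:)
  also have "\<dots> = (LINT z|circle_borel. cnj z * H ((T ^^ (n - m)) z))"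
    by (rule integral_funpow_T) (intro borel_measurable_times measurable_compose[OF funpow_T_measurable H]
        continuous_measurable_circle_borel continuous_intros)
  also have "\<dots> = deriv f 0 ^ (n - m) * (LINT z|circle_borel. cnj z * H z)"
    by (rule integral_cnj_funpow_T[OF H H_bound])
  also have "(LINT z|circle_borel. cnj z * H z) = (LINT z|circle_borel. G ((T ^^ (N - n)) z))"
    by (rule Bochner_Integration.integral_cong)
      (simp_all add: H_def cnj_mult_self_circle flip: mult.assoc)
  also have "\<dots> = (LINT z|circle_borel. G z)"
    by (rule integral_funpow_T[OF G])
  finally show ?thesis .
qed

text \<open>Conjugation reduces the case \<open>n < m\<close> to the ordered one. The value of the constant no longer matters
  from here on, only that it multiplies the integral of \<open>G\<close>.\<close>

lemma integral_correlation:
  fixes G :: "complex \<Rightarrow> complex"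
  assumes G: "G \<in> borel_measurable circle_borel"
    and bound: "\<And>z. cmod z = 1 \<Longrightarrow> cmod (G z) \<le> B"
    and le: "m \<le> N" "n \<le> N"
  shows "(LINT z|circle_borel. (T ^^ n) z * cnj ((T ^^ m) z) * G ((T ^^ N) z))
       = (LINT z|circle_borel. (T ^^ n) z * cnj ((T ^^ m) z)) * (LINT z|circle_borel. G z)"
proof -
  have main: "(LINT z|circle_borel. (T ^^ n) z * cnj ((T ^^ m) z) * K ((T ^^ N) z))
      = (if m \<le> n then deriv f 0 ^ (n - m) else cnj (deriv f 0 ^ (m - n))) * (LINT z|circle_borel. K z)"
    if K: "K \<in> borel_measurable circle_borel" "\<And>z. cmod z = 1 \<Longrightarrow> cmod (K z) \<le> C" for K C
  proof (cases "m \<le> n")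
    case True
    then show ?thesis using integral_correlation_ordered[OF K True le(2)] by simp
  next
    case False
    have cK: "(\<lambda>z. cnj (K z)) \<in> borel_measurable circle_borel"
      by (rule measurable_compose[OF K(1)])
        (intro borel_measurable_continuous_onI continuous_intros)
    have "(LINT z|circle_borel. (T ^^ n) z * cnj ((T ^^ m) z) * K ((T ^^ N) z))
        = cnj (LINT z|circle_borel. (T ^^ m) z * cnj ((T ^^ n) z) * cnj (K ((T ^^ N) z)))"
      by (simp add: mult.commute flip: Bochner_Integration.integral_cnj)
    also have "\<dots> = cnj (deriv f 0 ^ (m - n) * (LINT z|circle_borel. cnj (K z)))"
      using False le by (subst integral_correlation_ordered[OF cK, where B = C]) (simp_all add: K(2))
    finally show ?thesis using False by simp
  qed
  \<comment> \<open>the test function 1 identifies the constant as the correlation itself\<close>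
  have "(LINT z|circle_borel. (T ^^ n) z * cnj ((T ^^ m) z) * 1)
      = (if m \<le> n then deriv f 0 ^ (n - m) else cnj (deriv f 0 ^ (m - n))) * (LINT z|circle_borel. 1)"
    by (rule main[where K = "\<lambda>_. 1" and C = 1]) simp_all
  then show ?thesis
    using main[OF G bound] by simp
qed

definition block :: "(nat \<Rightarrow> complex) \<Rightarrow> nat set \<Rightarrow> complex \<Rightarrow> complex" where
  "block a A z = (\<Sum>n\<in>A. a n * (T ^^ n) z)"

lemma funpow_T_borel_measurable: "(\<lambda>z. (T ^^ n) z) \<in> borel_measurable circle_borel"
  using measurable_compose[OF funpow_T_measurable ident_measurable_circle_borel] .

lemma block_measurable: "block a A \<in> borel_measurable circle_borel"
  unfolding block_def
  by (intro borel_measurable_sum borel_measurable_times borel_measurable_const funpow_T_borel_measurable)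

lemma norm_block_le: "cmod z = 1 \<Longrightarrow> cmod (block a A z) \<le> (\<Sum>n\<in>A. cmod (a n))"
  unfolding block_def by (rule order_trans[OF norm_sum]) (simp add: norm_mult norm_funpow_T)

lemma integral_block_times_tail:
  fixes G :: "complex \<Rightarrow> real"
  assumes G: "G \<in> borel_measurable circle_borel"
    and bound: "\<And>z. cmod z = 1 \<Longrightarrow> \<bar>G z\<bar> \<le> B"
    and le: "\<And>n. n \<in> A \<Longrightarrow> n \<le> N"
  shows "(LINT z|circle_borel. (cmod (block a A z))\<^sup>2 * G ((T ^^ N) z))
       = (LINT z|circle_borel. (cmod (block a A z))\<^sup>2) * (LINT z|circle_borel. G z)"
proof -
  let ?I = "\<lambda>n m. LINT z|circle_borel. (T ^^ n) z * cnj ((T ^^ m) z)"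
  have expand: "(LINT z|circle_borel. complex_of_real ((cmod (block a A z))\<^sup>2 * K ((T ^^ N) z)))
      = (\<Sum>n\<in>A. \<Sum>m\<in>A. a n * cnj (a m) * ?I n m) * (LINT z|circle_borel. complex_of_real (K z))"
    if K: "K \<in> borel_measurable circle_borel" and C: "\<And>z. cmod z = 1 \<Longrightarrow> \<bar>K z\<bar> \<le> C" for K C
  proof -
    let ?t = "\<lambda>n m z. (T ^^ n) z * cnj ((T ^^ m) z) * complex_of_real (K ((T ^^ N) z))"
    have K': "(\<lambda>z. complex_of_real (K z)) \<in> borel_measurable circle_borel"
      using K by simp
    have int: "integrable circle_borel (?t n m)" for n m
    proof (rule integrable_circle_borel_bounded[where B = C])
      have "(\<lambda>z. cnj ((T ^^ m) z)) \<in> borel_measurable circle_borel"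
        by (rule measurable_compose[OF funpow_T_borel_measurable])
          (intro borel_measurable_continuous_onI continuous_intros)
      then show "?t n m \<in> borel_measurable circle_borel"
        by (intro borel_measurable_times funpow_T_borel_measurable
            measurable_compose[OF funpow_T_measurable K'])
      show "cmod (?t n m z) \<le> C" if "cmod z = 1" for z
        using C[OF norm_funpow_T[OF that]] that by (simp add: norm_mult norm_funpow_T)
    qed
    have "complex_of_real ((cmod (block a A z))\<^sup>2 * K ((T ^^ N) z))
        = (\<Sum>n\<in>A. \<Sum>m\<in>A. a n * cnj (a m) * ?t n m z)" for z
    proof -
      have "complex_of_real ((cmod (block a A z))\<^sup>2)
          = (\<Sum>n\<in>A. \<Sum>m\<in>A. a n * (T ^^ n) z * cnj (a m * (T ^^ m) z))"
        unfolding complex_norm_square block_def cnj_sum sum_product ..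
      then show ?thesis
        by (simp only: of_real_mult sum_distrib_right) (simp only: mult_ac complex_cnj_mult)
    qed
    then have "(LINT z|circle_borel. complex_of_real ((cmod (block a A z))\<^sup>2 * K ((T ^^ N) z)))
        = (LINT z|circle_borel. (\<Sum>n\<in>A. \<Sum>m\<in>A. a n * cnj (a m) * ?t n m z))"
      by (simp only:)
    also have "\<dots> = (\<Sum>n\<in>A. \<Sum>m\<in>A. a n * cnj (a m) * (LINT z|circle_borel. ?t n m z))"
      by (subst Bochner_Integration.integral_sum
          | intro Bochner_Integration.integrable_sum integrable_mult_right int sum.cong refl
            integral_mult_right_zero)+
    also have "\<dots> = (\<Sum>n\<in>A. \<Sum>m\<in>A. a n * cnj (a m) * ?I n m) * (LINT z|circle_borel. complex_of_real (K z))"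
      unfolding sum_distrib_right
      using integral_correlation[OF K', where B = C and N = N] C le
      by (intro sum.cong refl) (simp add: mult.assoc)
    finally show ?thesis .
  qed
  have one: "complex_of_real (LINT z|circle_borel. (cmod (block a A z))\<^sup>2)
      = (\<Sum>n\<in>A. \<Sum>m\<in>A. a n * cnj (a m) * ?I n m)"
    using expand[of "\<lambda>_. 1" 1] by (simp flip: of_real_power)
  have "complex_of_real (LINT z|circle_borel. (cmod (block a A z))\<^sup>2 * G ((T ^^ N) z))
      = (LINT z|circle_borel. complex_of_real ((cmod (block a A z))\<^sup>2 * G ((T ^^ N) z)))"
    by (rule integral_complex_of_real[symmetric])
  also have "\<dots> = (\<Sum>n\<in>A. \<Sum>m\<in>A. a n * cnj (a m) * ?I n m) * (LINT z|circle_borel. complex_of_real (G z))"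
    by (rule expand[OF G bound])
  also have "\<dots> = complex_of_real ((LINT z|circle_borel. (cmod (block a A z))\<^sup>2) * (LINT z|circle_borel. G z))"
    by (simp only: one integral_complex_of_real of_real_mult)
  finally show ?thesis
    by (simp only: of_real_eq_iff)
qed

text \<open>Splitting off the first block, the other ones are functions of \<open>T ^^ N\<close>, where \<open>N\<close> is the largest index
  of the first block: they are blocks in the indices \<open>n - N\<close>, evaluated at \<open>(T ^^ N) z\<close>.\<close>

lemma integral_prod_blocks:
  fixes A :: "nat \<Rightarrow> nat set" and p :: nat
  assumes "\<And>k. k \<in> {1..p} \<Longrightarrow> finite (A k) \<and> A k \<noteq> {}"
    and "\<And>i j m n. 1 \<le> i \<Longrightarrow> i < j \<Longrightarrow> j \<le> p \<Longrightarrow> m \<in> A i \<Longrightarrow> n \<in> A j \<Longrightarrow> m \<le> n"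
  shows "(LINT z|circle_borel. (\<Prod>k=1..p. (cmod (block a (A k) z))\<^sup>2))
       = (\<Prod>k=1..p. (LINT z|circle_borel. (cmod (block a (A k) z))\<^sup>2))"
  using assms
proof (induction p arbitrary: A)
  case 0
  show ?case by simp
next
  case (Suc p)
  define N where "N = Max (A 1)"
  have A1: "finite (A 1)" "A 1 \<noteq> {}" using Suc.prems(1)[of 1] by auto
  then have N: "N \<in> A 1" "\<And>n. n \<in> A 1 \<Longrightarrow> n \<le> N" by (auto simp: N_def)
  define b where "b n = a (n + N)" for n
  define S where "S k = (\<lambda>n. n - N) ` A (Suc k)" for k
  define G where "G z = (\<Prod>k=1..p. (cmod (block b (S k) z))\<^sup>2)" for z
  have ge: "N \<le> n" if "k \<in> {1..p}" "n \<in> A (Suc k)" for k n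
    using Suc.prems(2)[of 1 "Suc k" N n] that N(1) by auto
  have shift: "block a (A (Suc k)) z = block b (S k) ((T ^^ N) z)" if k: "k \<in> {1..p}" for k z
  proof -
    have "inj_on (\<lambda>n. n - N) (A (Suc k))"
      using ge[OF k] by (intro inj_onI) (metis le_add_diff_inverse2)
    then have "block b (S k) ((T ^^ N) z) = (\<Sum>n\<in>A (Suc k). b (n - N) * (T ^^ (n - N)) ((T ^^ N) z))"
      by (simp add: block_def S_def sum.reindex)
    also have "\<dots> = block a (A (Suc k)) z"
      unfolding block_def
    proof (intro sum.cong refl)
      fix n assume "n \<in> A (Suc k)"
      from ge[OF k this] show "b (n - N) * (T ^^ (n - N)) ((T ^^ N) z) = a n * (T ^^ n) z"
        unfolding b_def by (metis comp_apply funpow_add le_add_diff_inverse2)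
    qed
    finally show ?thesis by simp
  qed
  have G: "G \<in> borel_measurable circle_borel"
    unfolding G_def
    by (intro borel_measurable_prod borel_measurable_power measurable_compose[OF block_measurable]) simp
  have G_bound: "\<bar>G z\<bar> \<le> (\<Prod>k=1..p. (\<Sum>n\<in>S k. cmod (b n))\<^sup>2)" if "cmod z = 1" for z
    unfolding G_def by (auto simp: abs_prod intro!: prod_mono power_mono norm_block_le that)
  have split: "(\<Prod>k=1..Suc p. F k) = F 1 * (\<Prod>k=1..p. F (Suc k))" for F :: "nat \<Rightarrow> real"
    using prod.atLeast_Suc_atMost[of 1 "Suc p" F] by (simp only: prod.shift_bounds_cl_Suc_ivl)
  have tail: "(\<Prod>k=1..p. (cmod (block a (A (Suc k)) z))\<^sup>2) = G ((T ^^ N) z)" for z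
    unfolding G_def by (intro prod.cong refl) (simp add: shift)
  have "(LINT z|circle_borel. (\<Prod>k=1..Suc p. (cmod (block a (A k) z))\<^sup>2))
      = (LINT z|circle_borel. (cmod (block a (A 1) z))\<^sup>2 * G ((T ^^ N) z))"
    unfolding split tail ..
  also have "\<dots> = (LINT z|circle_borel. (cmod (block a (A 1) z))\<^sup>2) * (LINT z|circle_borel. G z)"
    by (rule integral_block_times_tail[OF G G_bound N(2)])
  also have "(LINT z|circle_borel. G z) = (LINT z|circle_borel. G ((T ^^ N) z))"
    using integral_distr[OF funpow_T_measurable G, of N] by (simp add: distr_funpow_T)
  also have "\<dots> = (LINT z|circle_borel. (\<Prod>k=1..p. (cmod (block a (A (Suc k)) z))\<^sup>2))"
    unfolding tail ..
  also have "\<dots> = (\<Prod>k=1..p. (LINT z|circle_borel. (cmod (block a (A (Suc k)) z))\<^sup>2))"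
  proof (rule Suc.IH)
    show "finite (A (Suc k)) \<and> A (Suc k) \<noteq> {}" if "k \<in> {1..p}" for k
      using that by (intro Suc.prems(1)) simp
    show "m \<le> n" if "1 \<le> i" "i < j" "j \<le> p" "m \<in> A (Suc i)" "n \<in> A (Suc j)" for i j m n
      by (rule Suc.prems(2)[OF _ _ _ that(4,5)]) (use that in simp_all)
  qed
  finally show ?case unfolding split .
qed

end

section \<open>Inner functions and their boundary functions\<close>

text \<open>A Borel version of the boundary function. The default value \<open>1\<close> makes it a self-map of the circle, so
  that its iterates stay there at every point.\<close>

definition radial_boundary :: "(complex \<Rightarrow> complex) \<Rightarrow> complex \<Rightarrow> complex" where
  "radial_boundary f z =
     (let w = lim (\<lambda>n. f (complex_of_real (radius n) * z)) in if cmod w = 1 then w else 1)"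

lemma radial_boundary_eqI:
  assumes "(\<lambda>n. f (complex_of_real (radius n) * z)) \<longlonglongrightarrow> w" "cmod w = 1"
  shows "radial_boundary f z = w"
  using limI[OF assms(1)] assms(2) by (simp add: radial_boundary_def)

lemma radial_boundary_measurable:
  assumes "continuous_on (ball 0 1) f"
  shows "radial_boundary f \<in> circle_borel \<rightarrow>\<^sub>M circle_borel"
proof (rule measurable_into_circle_borel)
  have lim: "(\<lambda>z. lim (\<lambda>n. f (complex_of_real (radius n) * z))) \<in> borel_measurable circle_borel"
    by (intro borel_measurable_lim_metric radial_sample_measurable assms)
  have "(\<lambda>w. if cmod w = 1 then w else 1) \<in> borel_measurable borel"
    by measurable
  from measurable_compose[OF lim this] show "radial_boundary f \<in> borel_measurable circle_borel"
    unfolding radial_boundary_def[abs_def] Let_def .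
qed (simp add: radial_boundary_def Let_def)

lemma inner_function_radial_limit:
  assumes "inner_function f"
  shows "AE z in circle_borel. (\<lambda>n. f (complex_of_real (radius n) * z)) \<longlonglongrightarrow> radial_boundary f z
           \<and> boundary_fun f z = radial_boundary f z"
proof -
  have "AE z in circle_borel.
      \<exists>w. ((\<lambda>r. f (complex_of_real r * z)) \<longlongrightarrow> w) (at_left 1) \<and> cmod w = 1"
    using assms unfolding inner_function_def circle_measure_eq_completion AE_completion_iff by blast
  then show ?thesis
  proof eventually_elim
    case (elim z)
    then obtain w where w: "((\<lambda>r. f (complex_of_real r * z)) \<longlongrightarrow> w) (at_left 1)" "cmod w = 1"
      by blast
    have lim: "(\<lambda>n. f (complex_of_real (radius n) * z)) \<longlonglongrightarrow> w"
      using filterlim_compose[OF w(1) radius_at_left] .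
    moreover have "boundary_fun f z = w"
      unfolding boundary_fun_def by (rule tendsto_Lim[OF _ w(1)]) simp
    ultimately show ?case using radial_boundary_eqI[OF lim w(2)] by simp
  qed
qed

lemma inner_function_boundary:
  assumes "inner_function f" "f 0 = 0"
  shows "disc_map_with_boundary f (radial_boundary f)"
proof
  show "f holomorphic_on ball 0 1" "f ` ball 0 1 \<subseteq> ball 0 1"
    using assms(1) by (simp_all add: inner_function_def)
  then show "radial_boundary f \<in> circle_borel \<rightarrow>\<^sub>M circle_borel"
    by (intro radial_boundary_measurable holomorphic_on_imp_continuous_on)
  show "AE z in circle_borel. (\<lambda>n. f (complex_of_real (radius n) * z)) \<longlonglongrightarrow> radial_boundary f z"
    using inner_function_radial_limit[OF assms(1)] by eventually_elim simp
qed (rule assms(2))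

text \<open>Since \<open>T\<close> preserves arc length, almost every orbit of \<open>T\<close> avoids the null set on which \<open>g\<close> and \<open>T\<close> differ.
  Hence exceptional values of a boundary function do not affect its iterates almost everywhere.\<close>

lemma (in disc_map_with_boundary) AE_funpow_eq:
  assumes "AE z in circle_borel. g z = T z"
  shows "AE z in circle_borel. \<forall>n. (g ^^ n) z = (T ^^ n) z"
proof -
  have "AE z in distr circle_borel circle_borel (T ^^ n). g z = T z" for n
    using assms by (simp only: distr_funpow_T)
  then have "AE z in circle_borel. g ((T ^^ n) z) = T ((T ^^ n) z)" for n
    by (rule AE_distrD[OF funpow_T_measurable])
  then have "AE z in circle_borel. \<forall>n. g ((T ^^ n) z) = T ((T ^^ n) z)"
    by (simp add: AE_all_countable)
  then show ?thesis
  proof eventually_elim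
    case (elim z)
    have "(g ^^ n) z = (T ^^ n) z" for n
      by (induction n) (simp_all add: elim)
    then show ?case ..
  qed
qed

section \<open>Integration with respect to a completion\<close>

lemma measurable_completion_AE_eq:
  assumes f: "f \<in> M \<rightarrow>\<^sub>M N" and g: "g \<in> space M \<rightarrow> space N"
    and eq: "AE x in M. f x = g x"
  shows "g \<in> completion M \<rightarrow>\<^sub>M N"
proof (rule measurableI)
  show "g x \<in> space N" if "x \<in> space (completion M)" for x
    using g that by auto
  obtain Z where Z: "Z \<in> null_sets M" "{x \<in> space M. f x \<noteq> g x} \<subseteq> Z"
    using eq by (auto simp: eventually_ae_filter)
  fix S assume S: "S \<in> sets N"
  have "(f -` S \<inter> space M) - Z \<in> sets (completion M)"
    using measurable_sets[OF f S] Z(1) by auto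
  moreover have "(g -` S \<inter> space M) \<inter> Z \<in> sets (completion M)"
    by (rule null_sets_completion[OF Z(1)]) auto
  moreover have "g -` S \<inter> space (completion M)
      = ((f -` S \<inter> space M) - Z) \<union> ((g -` S \<inter> space M) \<inter> Z)"
    using Z(2) by auto
  ultimately show "g -` S \<inter> space (completion M) \<in> sets (completion M)"
    by (simp only: sets.Un)
qed

lemma integral_completion_cong_AE:
  fixes f g :: "'a \<Rightarrow> 'b::{banach, second_countable_topology}"
  assumes f: "f \<in> borel_measurable M" and eq: "AE x in M. f x = g x"
  shows "(LINT x|completion M. g x) = (LINT x|M. f x)"
proof -
  have "(LINT x|completion M. g x) = (LINT x|completion M. f x)"
    using eq
    by (intro integral_cong_AE measurable_completion_AE_eq[OF f _ eq] measurable_completion f)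
      (auto simp: AE_completion_iff)
  then show ?thesis by (simp add: integral_completion[OF f])
qed

section \<open>Independence of squared moduli of consecutive blocks\<close>

lemma consecutive_blocks_ordered:
  fixes A :: "nat \<Rightarrow> nat set"
  assumes fin: "\<And>k. k \<in> {1..p} \<Longrightarrow> finite (A k) \<and> A k \<noteq> {}"
    and step: "\<And>k. k \<in> {1..<p} \<Longrightarrow> Max (A k) < Min (A (k + 1))"
    and ij: "1 \<le> i" "i < j" "j \<le> p" and mn: "m \<in> A i" "n \<in> A j"
  shows "m < n"
  using ij(2,3) mn(2)
proof (induction j arbitrary: n)
  case (Suc j)
  have j: "j \<in> {1..<p}" "j \<in> {1..p}" "Suc j \<in> {1..p}"
    using Suc.prems ij(1) by auto
  have "Max (A j) < n"
    using step[OF j(1)] Min_le[of "A (Suc j)" n] fin[OF j(3)] Suc.prems(3) by simp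
  moreover have "m \<le> Max (A j)"
  proof (cases "i = j")
    case True
    then show ?thesis using fin[OF j(2)] mn(1) by simp
  next
    case False
    then show ?thesis
      using Suc.IH[of "Max (A j)"] Suc.prems fin[OF j(2)] by simp
  qed
  ultimately show ?case by simp
qed simp

theorem theorem6:
  fixes f :: "complex \<Rightarrow> complex" and a :: "nat \<Rightarrow> complex"
    and A :: "nat \<Rightarrow> nat set" and p :: nat
  assumes "inner_function f" and "f 0 = 0"
    and "p \<ge> 1"
    and "\<And>k. k \<in> {1..p} \<Longrightarrow> finite (A k) \<and> A k \<noteq> {} \<and> (\<forall>n\<in>A k. n \<ge> 1)"
    and "\<And>k. k \<in> {1..<p} \<Longrightarrow> Max (A k) < Min (A (k + 1))"
  shows "(LINT z|circle_measure. (\<Prod>k=1..p. (cmod (iterate_sum f a (A k) z))\<^sup>2))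
       = (\<Prod>k=1..p. (LINT z|circle_measure. (cmod (iterate_sum f a (A k) z))\<^sup>2))"
proof -
  interpret disc_map_with_boundary f "radial_boundary f"
    by (rule inner_function_boundary[OF assms(1,2)])
  have "AE z in circle_borel. boundary_fun f z = radial_boundary f z"
    using inner_function_radial_limit[OF assms(1)] by eventually_elim simp
  from AE_funpow_eq[OF this]
  have eq: "AE z in circle_borel. \<forall>B. block a B z = iterate_sum f a B z"
    by eventually_elim (simp add: block_def iterate_sum_def)
  have single: "(LINT z|circle_measure. (cmod (iterate_sum f a B z))\<^sup>2)
      = (LINT z|circle_borel. (cmod (block a B z))\<^sup>2)" for B
    unfolding circle_measure_eq_completion
  proof (rule integral_completion_cong_AE)
    show "(\<lambda>z. (cmod (block a B z))\<^sup>2) \<in> borel_measurable circle_borel"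
      by (intro borel_measurable_power measurable_compose[OF block_measurable]) simp
    show "AE z in circle_borel. (cmod (block a B z))\<^sup>2 = (cmod (iterate_sum f a B z))\<^sup>2"
      using eq by eventually_elim simp
  qed
  have "(LINT z|circle_measure. (\<Prod>k=1..p. (cmod (iterate_sum f a (A k) z))\<^sup>2))
      = (LINT z|circle_borel. (\<Prod>k=1..p. (cmod (block a (A k) z))\<^sup>2))"
    unfolding circle_measure_eq_completion
  proof (rule integral_completion_cong_AE)
    show "(\<lambda>z. \<Prod>k=1..p. (cmod (block a (A k) z))\<^sup>2) \<in> borel_measurable circle_borel"
      by (intro borel_measurable_prod borel_measurable_power measurable_compose[OF block_measurable]) simp
    show "AE z in circle_borel. (\<Prod>k=1..p. (cmod (block a (A k) z))\<^sup>2)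
        = (\<Prod>k=1..p. (cmod (iterate_sum f a (A k) z))\<^sup>2)"
      using eq by eventually_elim simp
  qed
  also have "\<dots> = (\<Prod>k=1..p. (LINT z|circle_borel. (cmod (block a (A k) z))\<^sup>2))"
  proof (rule integral_prod_blocks)
    show ne: "finite (A k) \<and> A k \<noteq> {}" if "k \<in> {1..p}" for k
      using assms(4)[OF that] by simp
    show "m \<le> n" if "1 \<le> i" "i < j" "j \<le> p" "m \<in> A i" "n \<in> A j" for i j m n
      by (rule less_imp_le, rule consecutive_blocks_ordered[OF ne assms(5) that])
  qed
  finally show ?thesis by (simp only: single)
qed

end
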